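(* Let $G=(V,E)$ be a finite weighted graph with $|V|=N$ and symmetric real, possibly negative, weights $w_{uv}$ (nonzero only on $E$), and let $H=\mathcal{L}+W$ be a real symmetric matrix with eigenvalues $\lambda_0<\lambda_1\le\dots\le\lambda_{N-1}$ and corresponding ground-state $\phi\ge0$, where $\mathcal{L}$ is the normalized Laplacian of $G$ and $W$ is a real diagonal matrix. Suppose that $G^+$ is connected and that admissible routings $\alpha$ exist. Then $$\lambda_1-\lambda_0\ \ge\ (1+\rho)-\sqrt{(1+\rho)^2-h^2},$$ where $\rho=\lambda_{N-1}-\lambda_0$ and $h$ is the distributed Cheeger constant $$h=\sup_{\alpha\ \text{admissible}}h_\alpha,\qquad h_\alpha=\min_{\emptyset\ne S\subsetneq V}\ \max_{S'\in\{S,\overline S\}}\frac{\sum_{\{u,v\}\in\partial S}\omega_{uv}(\alpha)}{\sum_{u\in S'}d_u\phi^2(u)} .$$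
   Context: $d_u=\sum_v w_{uv}$, assumed positive for all $u$; the normalized Laplacian has entries $\mathcal L(u,u)=1$ and $\mathcal L(u,v)=-w_{uv}/\sqrt{d_ud_v}$ for $u\ne v$. The ground-state is taken in the form $\phi\not\equiv0$ solving $(\lambda_0-W_u)d_u\phi(u)=\sum_v w_{uv}[\phi(u)-\phi(v)]$, i.e. $\phi(u)=f(u)/\sqrt{d_u}$ with $f$ an eigenvector of $H$ for $\lambda_0$. $E^+=\{\{u,v\}\in E: w_{uv}>0\}$, $E^-=\{\{u,v\}\in E:w_{uv}<0\}$, and $G^+=(V,E^+)$. $P(x,y)$ is the set of paths from $x$ to $y$ in $G^+$; $\ell_p$ is the length (number of edges) of a path $p$. A routing is a function $\alpha$ assigning to each path $p\in\bigcup_{\{x,y\}\in E}P(x,y)$ a weight $\alpha_p\in[0,1]$, $\alpha_p>0$, with $\sum_{p\in P(x,y)}\alpha_p=1$ for every edge $\{x,y\}\in E$. For $\{u,v\}\in E^+$ put $$\omega_{uv}(\alpha)=w_{uv}\phi(u)\phi(v)-\sum_{\{x,y\}:\,w_{xy}<0}\ \sum_{p\in P(x,y),\ \{u,v\}\in p}|w_{xy}|\,\ell_p\,\alpha_p\,\phi(x)\phi(y).$$ A routing $\alpha$ is called admissible if $\omega_{uv}(\alpha)>0$ for all $\{u,v\}\in E^+$. For $S\subset V$, $\overline S=V\setminus S$ and $\partial S$ is the set of edges of $G^+$ with exactly one endpoint in $S$. *)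

theory Defs
  imports "HOL-Analysis.Analysis"
begin

text \<open>
  Vertices are the elements of a finite type. A graph is a set of two-element sets of vertices,
  the weights are a symmetric function of two vertices.
  Sums over unordered edges of expressions in their end points use the following lifting;
  it is meaningful for functions that are symmetric in the two arguments.
\<close>

definition on_edge :: "('v \<Rightarrow> 'v \<Rightarrow> 'a) \<Rightarrow> 'v set \<Rightarrow> 'a" where
  "on_edge f e = (THE r. \<forall>x y. e = {x, y} \<longrightarrow> f x y = r)"

lemma on_edge_doubleton:
  assumes "f x y = f y x"
  shows "on_edge f {x, y} = f x y"
  unfolding on_edge_def using assms by (intro the_equality) (auto simp: doubleton_eq_iff)

definition pos_edges :: "'v set set \<Rightarrow> ('v \<Rightarrow> 'v \<Rightarrow> real) \<Rightarrow> 'v set set" where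
  "pos_edges E w = {{u, v} | u v. {u, v} \<in> E \<and> w u v > 0}"

definition neg_edges :: "'v set set \<Rightarrow> ('v \<Rightarrow> 'v \<Rightarrow> real) \<Rightarrow> 'v set set" where
  "neg_edges E w = {{u, v} | u v. {u, v} \<in> E \<and> w u v < 0}"

definition deg :: "('v::finite \<Rightarrow> 'v \<Rightarrow> real) \<Rightarrow> 'v \<Rightarrow> real" where
  "deg w u = (\<Sum>v\<in>UNIV. w u v)"

definition normalized_laplacian :: "('v::finite \<Rightarrow> 'v \<Rightarrow> real) \<Rightarrow> real^'v^'v" where
  "normalized_laplacian w =
     (\<chi> u v. if u = v then 1 else - w u v / sqrt (deg w u * deg w v))"

definition diagonal_matrix :: "('v::finite \<Rightarrow> real) \<Rightarrow> real^'v^'v" where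
  "diagonal_matrix W = (\<chi> u v. if u = v then W u else 0)"

text \<open>
  The values \<open>lam 0 \<le> \<dots> \<le> lam (N - 1)\<close> are the eigenvalues of \<open>A\<close>, counted with multiplicity
  as roots of the characteristic polynomial. The other values of \<open>lam\<close> are irrelevant.
\<close>

definition ordered_eigenvalues :: "real^'v^'v::finite \<Rightarrow> (nat \<Rightarrow> real) \<Rightarrow> bool" where
  "ordered_eigenvalues A lam \<longleftrightarrow>
     (\<forall>i j. i \<le> j \<and> j < CARD('v) \<longrightarrow> lam i \<le> lam j) \<and>
     (\<forall>x. det (mat x - A) = (\<Prod>i<CARD('v). x - lam i))"

text \<open>
  For \<open>\<mu>\<close> the least eigenvalue of \<open>normalized_laplacian w + diagonal_matrix W\<close>, this is the
  eigenvector equation for the vector with entries \<open>sqrt (deg w u) * \<phi> u\<close>.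
\<close>

definition ground_state ::
    "('v::finite \<Rightarrow> 'v \<Rightarrow> real) \<Rightarrow> ('v \<Rightarrow> real) \<Rightarrow> real \<Rightarrow> ('v \<Rightarrow> real) \<Rightarrow> bool" where
  "ground_state w W \<mu> \<phi> \<longleftrightarrow>
     (\<exists>u. \<phi> u \<noteq> 0) \<and>
     (\<forall>u. (\<mu> - W u) * deg w u * \<phi> u = (\<Sum>v\<in>UNIV. w u v * (\<phi> u - \<phi> v)))"

definition list_edges :: "'v list \<Rightarrow> 'v set set" where
  "list_edges xs = {{xs ! i, xs ! Suc i} | i. Suc i < length xs}"

text \<open>
  A path is represented by its set of edges, so that a path and its reverse are the same
  object and the length of a path \<open>p\<close> is \<open>card p\<close>. Paths do not repeat vertices.
\<close>

definition paths :: "'v set set \<Rightarrow> 'v \<Rightarrow> 'v \<Rightarrow> 'v set set set" where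
  "paths F x y =
     {list_edges xs | xs. xs \<noteq> [] \<and> distinct xs \<and> hd xs = x \<and> last xs = y \<and> list_edges xs \<subseteq> F}"

definition connected_graph :: "'v set set \<Rightarrow> bool" where
  "connected_graph F \<longleftrightarrow> (\<forall>x y. paths F x y \<noteq> {})"

text \<open>Only the values of a routing on paths that join the end points of an edge matter.\<close>

definition routing ::
    "'v set set \<Rightarrow> ('v \<Rightarrow> 'v \<Rightarrow> real) \<Rightarrow> ('v set set \<Rightarrow> real) \<Rightarrow> bool" where
  "routing E w \<alpha> \<longleftrightarrow>
     (\<forall>x y. {x, y} \<in> E \<longrightarrow>
        (\<forall>p\<in>paths (pos_edges E w) x y. 0 < \<alpha> p \<and> \<alpha> p \<le> 1) \<and>
        (\<Sum>p\<in>paths (pos_edges E w) x y. \<alpha> p) = 1)"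

definition routed_weight ::
    "'v set set \<Rightarrow> ('v \<Rightarrow> 'v \<Rightarrow> real) \<Rightarrow> ('v \<Rightarrow> real) \<Rightarrow> ('v set set \<Rightarrow> real) \<Rightarrow> 'v \<Rightarrow> 'v \<Rightarrow> real" where
  "routed_weight E w \<phi> \<alpha> u v =
     w u v * \<phi> u * \<phi> v -
     (\<Sum>e\<in>neg_edges E w.
        on_edge (\<lambda>x y. \<Sum>p | p \<in> paths (pos_edges E w) x y \<and> {u, v} \<in> p.
          \<bar>w x y\<bar> * real (card p) * \<alpha> p * \<phi> x * \<phi> y) e)"

definition admissible ::
    "'v set set \<Rightarrow> ('v \<Rightarrow> 'v \<Rightarrow> real) \<Rightarrow> ('v \<Rightarrow> real) \<Rightarrow> ('v set set \<Rightarrow> real) \<Rightarrow> bool" where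
  "admissible E w \<phi> \<alpha> \<longleftrightarrow>
     routing E w \<alpha> \<and> (\<forall>u v. {u, v} \<in> pos_edges E w \<longrightarrow> routed_weight E w \<phi> \<alpha> u v > 0)"

definition edge_boundary :: "'v set set \<Rightarrow> 'v set \<Rightarrow> 'v set set" where
  "edge_boundary F S = {{u, v} | u v. {u, v} \<in> F \<and> u \<in> S \<and> v \<notin> S}"

definition routed_cheeger ::
    "'v::finite set set \<Rightarrow> ('v \<Rightarrow> 'v \<Rightarrow> real) \<Rightarrow> ('v \<Rightarrow> real) \<Rightarrow> ('v set set \<Rightarrow> real) \<Rightarrow> real" where
  "routed_cheeger E w \<phi> \<alpha> =
     (MIN S\<in>{S. S \<noteq> {} \<and> S \<noteq> UNIV}. MAX S'\<in>{S, - S}.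
        (\<Sum>e\<in>edge_boundary (pos_edges E w) S. on_edge (routed_weight E w \<phi> \<alpha>) e) /
        (\<Sum>u\<in>S'. deg w u * (\<phi> u)\<^sup>2))"

text \<open>
  For a ground state of a connected positive graph with at least two vertices, the supremum is
  over a bounded set: for a single vertex \<open>u\<close> of at most half the total volume, the edge boundary
  of \<open>{u}\<close> carries at most \<open>\<Sum>v. w u v * \<phi> u * \<phi> v = (1 + W u - \<mu>) * deg w u * (\<phi> u)\<^sup>2\<close>.
\<close>

definition distributed_cheeger ::
    "'v::finite set set \<Rightarrow> ('v \<Rightarrow> 'v \<Rightarrow> real) \<Rightarrow> ('v \<Rightarrow> real) \<Rightarrow> real" where
  "distributed_cheeger E w \<phi> = (SUP \<alpha>\<in>{\<alpha>. admissible E w \<phi> \<alpha>}. routed_cheeger E w \<phi> \<alpha>)"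

lemma list_edges_rev: "list_edges (rev xs) = list_edges xs"
proof -
  have sub: "list_edges (rev ys) \<subseteq> list_edges ys" for ys :: "'a list"
  proof
    fix e assume "e \<in> list_edges (rev ys)"
    then obtain i where i: "Suc i < length ys" "e = {rev ys ! i, rev ys ! Suc i}"
      by (auto simp: list_edges_def)
    define j where "j = length ys - Suc (Suc i)"
    have "e = {ys ! j, ys ! Suc j}" "Suc j < length ys"
      using i by (auto simp: j_def rev_nth Suc_diff_Suc insert_commute)
    then show "e \<in> list_edges ys" by (auto simp: list_edges_def)
  qed
  from sub[of xs] sub[of "rev xs"] show ?thesis by auto
qed

lemma paths_commute: "paths F x y = paths F y x"
proof -
  have "paths F a b \<subseteq> paths F b a" for a b
  proof
    fix p assume "p \<in> paths F a b"
    then obtain xs where "p = list_edges xs" "xs \<noteq> []" "distinct xs" "hd xs = a" "last xs = b"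
      "list_edges xs \<subseteq> F" by (auto simp: paths_def)
    then show "p \<in> paths F b a"
      unfolding paths_def
      by (auto intro!: exI[of _ "rev xs"] simp: list_edges_rev hd_rev last_rev)
  qed
  then show ?thesis by blast
qed

lemma routed_weight_commute:
  assumes "\<And>x y. w x y = w y x"
  shows "routed_weight E w \<phi> \<alpha> u v = routed_weight E w \<phi> \<alpha> v u"
  unfolding routed_weight_def by (simp add: assms[of u v] insert_commute mult.assoc mult.commute[of "\<phi> u"])

lemma on_edge_route_sum:
  assumes "\<And>x y. w x y = w y x"
  shows "on_edge (\<lambda>x y. \<Sum>p | p \<in> paths F x y \<and> {u, v} \<in> p.
            \<bar>w x y\<bar> * real (card p) * \<alpha> p * \<phi> x * \<phi> y) {a, b} =
         (\<Sum>p | p \<in> paths F a b \<and> {u, v} \<in> p. \<bar>w a b\<bar> * real (card p) * \<alpha> p * \<phi> a * \<phi> b)"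
  by (rule on_edge_doubleton) (simp add: assms[of b a] paths_commute[of F b a] mult_ac)

end

theory Submission
  imports Defs
begin

text \<open>
  Write \<open>H\<close> for the matrix, \<open>m u = deg w u * (\<phi> u)\<^sup>2\<close> and \<open>l = lam 1 - lam 0\<close>. Conjugation by the
  ground state (\<open>ground_state_transform\<close>) turns the quadratic form of \<open>H - lam 0\<close> into the Dirichlet
  form with weights \<open>w u v \<phi> u \<phi> v\<close> on functions with mass \<open>m\<close>, and an eigenvector for \<open>lam 1\<close>, being
  orthogonal to the ground state, becomes a function \<open>g\<close> with \<open>\<Sum>u. m u * g u = 0\<close> and Rayleigh
  quotient \<open>l\<close>.

  The weights may be negative, but an admissible routing dominates each negative edge by positive
  paths. A Poincare inequality along the paths shows that the Dirichlet form of the routed weights,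
  which are nonnegative, is at most the original one for every function
  (\<open>dirichlet_form_routed_le\<close>). Therefore \<open>g\<close> has Rayleigh quotient at most \<open>l\<close> for the routed form
  too.

  For nonnegative weights the Cheeger argument applies (\<open>cheeger_inequality\<close>). The usual version
  restricts the eigenvalue equation to the set where the eigenfunction is positive; here \<open>g\<close> is an
  eigenfunction of the original form only, and restricting that form to the positive part of \<open>g\<close> may
  increase the Rayleigh quotient because of the negative edges. Splitting \<open>g\<close> at a weighted median
  avoids the equation: it uses only the Rayleigh quotient of \<open>g\<close> for the routed form. With routed
  degrees at most \<open>(1 + \<rho>) * m u\<close>, which follows from the same comparison of forms and the
  variational characterisation of the largest eigenvalue, and with \<open>l \<le> \<rho>\<close>, one obtains
  \<open>h\<^sub>\<alpha>\<^sup>2 \<le> l * (2 * (1 + \<rho>) - l) = (1 + \<rho>)\<^sup>2 - (1 + \<rho> - l)\<^sup>2\<close> for every admissible \<open>\<alpha>\<close>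
  (\<open>routed_cheeger_bound\<close>). The right-hand side does not depend on \<open>\<alpha>\<close>, so the bound passes to the
  supremum, and taking roots gives the claim.
\<close>

section \<open>Dirichlet forms with nonnegative weights and the Cheeger inequality\<close>

text \<open>
  The sum runs over ordered pairs, so every edge occurs twice; the factor \<open>1/2\<close> makes this the
  usual sum over unordered edges.
\<close>

definition dirichlet_form :: "('v::finite \<Rightarrow> 'v \<Rightarrow> real) \<Rightarrow> ('v \<Rightarrow> real) \<Rightarrow> real" where
  "dirichlet_form k g = (\<Sum>u\<in>UNIV. \<Sum>v\<in>UNIV. k u v * (g u - g v)\<^sup>2) / 2"

definition cut_weight :: "('v::finite \<Rightarrow> 'v \<Rightarrow> real) \<Rightarrow> 'v set \<Rightarrow> real" where
  "cut_weight k S = (\<Sum>u\<in>S. \<Sum>v\<in>-S. k u v)"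

lemma dirichlet_form_nonneg:
  assumes "\<And>u v. k u v \<ge> 0"
  shows "dirichlet_form k g \<ge> 0"
  unfolding dirichlet_form_def using assms by (simp add: sum_nonneg)

text \<open>
  Testing a Dirichlet form on a single vertex recovers the weighted degree of that vertex. In this
  way a comparison of two Dirichlet forms also compares degrees.
\<close>

lemma dirichlet_form_indicator:
  fixes k :: "'v::finite \<Rightarrow> 'v \<Rightarrow> real"
  assumes sym: "\<And>u v. k u v = k v u" and diag: "\<And>u. k u u = 0"
  shows "dirichlet_form k (indicator {a}) = (\<Sum>v\<in>UNIV. k a v)"
proof -
  have "k u v * (indicator {a} u - indicator {a} v)\<^sup>2
      = (if u = a then k a v else 0) + (if v = a then k a u else 0)" for u v
    using sym diag by (auto simp: indicator_def)
  then have "(\<Sum>u\<in>UNIV. \<Sum>v\<in>UNIV. k u v * (indicator {a} u - indicator {a} v)\<^sup>2)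
      = (\<Sum>u\<in>UNIV. \<Sum>v\<in>UNIV. if u = a then k a v else 0)
        + (\<Sum>u\<in>UNIV. \<Sum>v\<in>UNIV. if v = a then k a u else 0)"
    by (simp add: sum.distrib)
  also have "(\<Sum>u\<in>UNIV. \<Sum>v\<in>UNIV. if u = a then k a v else 0) = (\<Sum>v\<in>UNIV. k a v)"
    by (subst sum.swap) simp
  finally show ?thesis by (simp add: dirichlet_form_def)
qed

lemma total_variation_indicator:
  fixes k :: "'v::finite \<Rightarrow> 'v \<Rightarrow> real"
  assumes sym: "\<And>u v. k u v = k v u"
  shows "(\<Sum>u\<in>UNIV. \<Sum>v\<in>UNIV. k u v * \<bar>indicator S u - indicator S v\<bar>) = 2 * cut_weight k S"
proof -
  have "k u v * \<bar>indicator S u - indicator S v\<bar>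
      = (if u \<in> S then (if v \<in> -S then k u v else 0) else 0)
        + (if v \<in> S then (if u \<in> -S then k v u else 0) else 0)" for u v
    using sym[of u v] by (auto simp: indicator_def)
  then have "(\<Sum>u\<in>UNIV. \<Sum>v\<in>UNIV. k u v * \<bar>indicator S u - indicator S v\<bar>)
     = (\<Sum>u\<in>UNIV. \<Sum>v\<in>UNIV. (if u \<in> S then (if v \<in> -S then k u v else 0) else 0))
      + (\<Sum>u\<in>UNIV. \<Sum>v\<in>UNIV. (if v \<in> S then (if u \<in> -S then k v u else 0) else 0))"
    by (simp only: sum.distrib)
  also have "(\<Sum>u\<in>UNIV. \<Sum>v\<in>UNIV. (if v \<in> S then (if u \<in> -S then k v u else 0) else 0))
     = (\<Sum>u\<in>UNIV. \<Sum>v\<in>UNIV. (if u \<in> S then (if v \<in> -S then k u v else 0) else 0))"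
    by (rule sum.swap)
  also have "(\<Sum>u\<in>UNIV. \<Sum>v\<in>UNIV. (if u \<in> S then (if v \<in> -S then k u v else 0) else 0))
     = (\<Sum>u\<in>UNIV. if u \<in> S then \<Sum>v\<in>UNIV. (if v \<in> -S then k u v else 0) else 0)"
    by (intro sum.cong) auto
  also have "\<dots> = cut_weight k S"
    unfolding cut_weight_def
    by (simp add: sum.If_cases Compl_eq)
  finally show ?thesis by simp
qed

text \<open>
  Both sides are additive over the level sets of \<open>b\<close>: as a positive combination of indicators of
  nested sets, \<open>b\<close> has total variation equal to the same combination of cuts, so the isoperimetric
  inequality for each level set gives the claim. The induction removes one level at a time. The
  factor 2 comes from summing over ordered pairs.
\<close>

lemma coarea_inequality:
  fixes k :: "'v::finite \<Rightarrow> 'v \<Rightarrow> real" and m b :: "'v \<Rightarrow> real"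
  assumes sym: "\<And>u v. k u v = k v u"
    and iso: "\<And>T. T \<noteq> {} \<Longrightarrow> T \<subseteq> S \<Longrightarrow> h * sum m T \<le> cut_weight k T"
    and "\<And>u. b u \<ge> 0" and "{u. b u \<noteq> 0} \<subseteq> S"
  shows "2 * h * (\<Sum>u\<in>UNIV. m u * b u) \<le> (\<Sum>u\<in>UNIV. \<Sum>v\<in>UNIV. k u v * \<bar>b u - b v\<bar>)"
  using assms(3,4)
proof (induction "card {u. b u \<noteq> 0}" arbitrary: b rule: less_induct)
  case less
  define T where "T = {u. b u \<noteq> 0}"
  show ?case
  proof (cases "T = {}")
    case True
    then show ?thesis by (auto simp: T_def)
  next
    case False
    define c where "c = Min (b ` T)"
    have "c \<in> b ` T" unfolding c_def using False by (intro Min_in) auto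
    then obtain t where t: "t \<in> T" "b t = c" by auto
    have c_pos: "c > 0" using t less.prems(1)[of t] by (auto simp: T_def order_less_le)
    have c_le: "c \<le> b u" if "u \<in> T" for u unfolding c_def using that by simp
    \<comment> \<open>Peeling off the lowest positive level: the remainder vanishes at \<open>t\<close>.\<close>
    define b' where "b' u = b u - c * indicator T u" for u
    have b'_nonneg: "b' u \<ge> 0" for u
      using c_le[of u] less.prems(1)[of u] by (auto simp: b'_def indicator_def)
    have sub: "{u. b' u \<noteq> 0} \<subseteq> T" by (auto simp: b'_def T_def indicator_def)
    have "t \<notin> {u. b' u \<noteq> 0}" using t by (simp add: b'_def)
    with sub t have psub: "{u. b' u \<noteq> 0} \<subset> T" by blast
    have "card {u. b' u \<noteq> 0} < card T" by (rule psubset_card_mono[OF _ psub]) simp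
    then have IH: "2 * h * (\<Sum>u\<in>UNIV. m u * b' u) \<le> (\<Sum>u\<in>UNIV. \<Sum>v\<in>UNIV. k u v * \<bar>b' u - b' v\<bar>)"
      using sub less.prems(2) by (intro less.hyps b'_nonneg) (auto simp: T_def)
    have T_bound: "h * sum m T \<le> cut_weight k T" using less.prems(2) False by (intro iso) (auto simp: T_def)
    have abs_split: "\<bar>b u - b v\<bar> = \<bar>b' u - b' v\<bar> + c * \<bar>indicator T u - indicator T v\<bar>" for u v
    proof -
      have "b z = 0" "b' z = 0" if "z \<notin> T" for z using that by (auto simp: T_def b'_def)
      then show ?thesis
        using c_pos b'_nonneg[of u] b'_nonneg[of v] less.prems(1)[of u] less.prems(1)[of v]
        by (cases "u \<in> T"; cases "v \<in> T") (auto simp: b'_def)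
    qed
    have m_ind: "(\<Sum>u\<in>UNIV. m u * indicator T u) = sum m T"
      by (simp add: indicator_def if_distrib sum.inter_restrict[symmetric, where A=UNIV, simplified] cong: if_cong)
    have "2 * h * (\<Sum>u\<in>UNIV. m u * b u)
        = 2 * h * (\<Sum>u\<in>UNIV. m u * b' u + c * (m u * indicator T u))"
      by (simp add: b'_def algebra_simps)
    also have "\<dots> = 2 * h * (\<Sum>u\<in>UNIV. m u * b' u) + 2 * c * (h * sum m T)"
      by (simp add: sum.distrib sum_distrib_left[symmetric] m_ind algebra_simps)
    also have "\<dots> \<le> (\<Sum>u\<in>UNIV. \<Sum>v\<in>UNIV. k u v * \<bar>b' u - b' v\<bar>) + 2 * c * cut_weight k T"
      using IH T_bound c_pos by (intro add_mono mult_left_mono) auto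
    also have "2 * c * cut_weight k T = c * (\<Sum>u\<in>UNIV. \<Sum>v\<in>UNIV. k u v * \<bar>indicator T u - indicator T v\<bar>)"
      by (simp add: total_variation_indicator[OF sym])
    also have "(\<Sum>u\<in>UNIV. \<Sum>v\<in>UNIV. k u v * \<bar>b' u - b' v\<bar>) + \<dots>
        = (\<Sum>u\<in>UNIV. \<Sum>v\<in>UNIV. k u v * \<bar>b u - b v\<bar>)"
      by (simp add: abs_split sum.distrib sum_distrib_left algebra_simps)
    finally show ?thesis .
  qed
qed

text \<open>
  The coarea inequality for \<open>b = a\<^sup>2\<close>, followed by Cauchy-Schwarz for the factorisation
  \<open>\<bar>a u\<^sup>2 - a v\<^sup>2\<bar> = \<bar>a u - a v\<bar> * (a u + a v)\<close>. The second factor is handled by the parallelogram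
  identity \<open>(a u + a v)\<^sup>2 = 2 (a u)\<^sup>2 + 2 (a v)\<^sup>2 - (a u - a v)\<^sup>2\<close> instead of the cruder bound without
  the last term; this is what produces the square root form of the gap estimate.
\<close>

lemma cheeger_inequality_supported:
  fixes k :: "'v::finite \<Rightarrow> 'v \<Rightarrow> real" and m a :: "'v \<Rightarrow> real"
  assumes sym: "\<And>u v. k u v = k v u" and nonneg: "\<And>u v. k u v \<ge> 0"
    and degree: "\<And>u. (\<Sum>v\<in>UNIV. k u v) \<le> C * m u"
    and h: "h \<ge> 0"
    and iso: "\<And>T. T \<noteq> {} \<Longrightarrow> T \<subseteq> {u. a u \<noteq> 0} \<Longrightarrow> h * sum m T \<le> cut_weight k T"
    and a: "\<And>u. a u \<ge> 0" and m: "\<And>u. m u \<ge> 0"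
  shows "h\<^sup>2 * (\<Sum>u\<in>UNIV. m u * (a u)\<^sup>2)\<^sup>2
      \<le> dirichlet_form k a * (2 * C * (\<Sum>u\<in>UNIV. m u * (a u)\<^sup>2) - dirichlet_form k a)"
proof -
  define M where "M = (\<Sum>u\<in>UNIV. m u * (a u)\<^sup>2)"
  define D where "D = dirichlet_form k a"
  define P where "P = (\<Sum>u\<in>UNIV. \<Sum>v\<in>UNIV. k u v * (a u + a v)\<^sup>2)"
  have M0: "M \<ge> 0" unfolding M_def using m by (simp add: sum_nonneg)
  have D0: "D \<ge> 0" unfolding D_def by (rule dirichlet_form_nonneg[OF nonneg])
  have coarea: "2 * h * M \<le> (\<Sum>u\<in>UNIV. \<Sum>v\<in>UNIV. k u v * \<bar>(a u)\<^sup>2 - (a v)\<^sup>2\<bar>)"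
    unfolding M_def by (rule coarea_inequality[OF sym iso, where S = "{u. a u \<noteq> 0}"]) auto
  have "(\<Sum>u\<in>UNIV. \<Sum>v\<in>UNIV. k u v * \<bar>(a u)\<^sup>2 - (a v)\<^sup>2\<bar>)\<^sup>2
      = (\<Sum>z\<in>UNIV\<times>UNIV. (sqrt (k (fst z) (snd z)) * \<bar>a (fst z) - a (snd z)\<bar>) *
                        (sqrt (k (fst z) (snd z)) * (a (fst z) + a (snd z))))\<^sup>2"
  proof -
    have "k u v * \<bar>(a u)\<^sup>2 - (a v)\<^sup>2\<bar>
      = (sqrt (k u v) * \<bar>a u - a v\<bar>) * (sqrt (k u v) * (a u + a v))" for u v
    proof -
      have "\<bar>(a u)\<^sup>2 - (a v)\<^sup>2\<bar> = \<bar>a u - a v\<bar> * (a u + a v)"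
        using a[of u] a[of v] by (simp add: power2_eq_square square_diff_square_factored abs_mult mult.commute)
      moreover have "k u v = sqrt (k u v) * sqrt (k u v)" using nonneg[of u v] by simp
      ultimately show ?thesis by (metis mult.assoc mult.left_commute)
    qed
    then show ?thesis by (simp add: sum.cartesian_product case_prod_unfold)
  qed
  also have "\<dots> \<le> (\<Sum>z\<in>UNIV\<times>UNIV. (sqrt (k (fst z) (snd z)) * \<bar>a (fst z) - a (snd z)\<bar>)\<^sup>2) *
                 (\<Sum>z\<in>UNIV\<times>UNIV. (sqrt (k (fst z) (snd z)) * (a (fst z) + a (snd z)))\<^sup>2)"
    by (rule Cauchy_Schwarz_ineq_sum)
  also have "\<dots> = (2 * D) * P"
    using nonneg by (simp add: D_def P_def dirichlet_form_def sum.cartesian_product case_prod_unfold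
        power_mult_distrib)
  finally have CS: "(\<Sum>u\<in>UNIV. \<Sum>v\<in>UNIV. k u v * \<bar>(a u)\<^sup>2 - (a v)\<^sup>2\<bar>)\<^sup>2 \<le> (2 * D) * P" .
  have swap: "(\<Sum>u\<in>UNIV. \<Sum>v\<in>UNIV. k u v * (a v)\<^sup>2) = (\<Sum>u\<in>UNIV. \<Sum>v\<in>UNIV. k u v * (a u)\<^sup>2)"
    by (subst sum.swap, intro sum.cong refl) (simp add: sym)
  have "P + 2 * D = (\<Sum>u\<in>UNIV. \<Sum>v\<in>UNIV. 2 * (k u v * (a u)\<^sup>2) + 2 * (k u v * (a v)\<^sup>2))"
    by (simp add: P_def D_def dirichlet_form_def flip: sum.distrib)
       (intro sum.cong refl, simp add: power2_eq_square algebra_simps)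
  also have "\<dots> = 4 * (\<Sum>u\<in>UNIV. \<Sum>v\<in>UNIV. k u v * (a u)\<^sup>2)"
    by (simp add: sum.distrib swap flip: sum_distrib_left)
  also have "(\<Sum>u\<in>UNIV. \<Sum>v\<in>UNIV. k u v * (a u)\<^sup>2) = (\<Sum>u\<in>UNIV. (\<Sum>v\<in>UNIV. k u v) * (a u)\<^sup>2)"
    by (simp add: sum_distrib_right)
  also have "4 * \<dots> \<le> 4 * (\<Sum>u\<in>UNIV. C * m u * (a u)\<^sup>2)"
    using degree by (intro mult_left_mono sum_mono mult_right_mono) auto
  also have "(\<Sum>u\<in>UNIV. C * m u * (a u)\<^sup>2) = C * M"
    by (simp add: M_def sum_distrib_left mult.assoc)
  finally have P: "P \<le> 4 * (C * M) - 2 * D" by simp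
  have "(2 * h * M)\<^sup>2 \<le> (\<Sum>u\<in>UNIV. \<Sum>v\<in>UNIV. k u v * \<bar>(a u)\<^sup>2 - (a v)\<^sup>2\<bar>)\<^sup>2"
    using coarea h M0 by (intro power_mono) auto
  also note CS
  also have "(2 * D) * P \<le> (2 * D) * (4 * (C * M) - 2 * D)"
    using P D0 by (intro mult_left_mono) auto
  finally have "4 * (h\<^sup>2 * M\<^sup>2) \<le> 4 * (D * (2 * C * M - D))"
    by (simp add: power2_eq_square algebra_simps)
  then show ?thesis by (simp add: M_def D_def)
qed

text \<open>
  A suitable \<open>c\<close> is the smallest value of \<open>g\<close> above which lies at most half of the total mass.
\<close>

lemma weighted_median_exists:
  fixes m g :: "'v::finite \<Rightarrow> real"
  assumes m: "\<And>u. m u > 0"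
  obtains c where "sum m {u. g u > c} \<le> sum m (- {u. g u > c})"
    and "sum m {u. g u < c} \<le> sum m (- {u. g u < c})"
proof -
  define A where "A = {c \<in> range g. sum m {u. g u > c} \<le> sum m (- {u. g u > c})}"
  have "Max (range g) \<in> A"
  proof -
    have "{u. g u > Max (range g)} = {}" by (auto simp: not_less)
    moreover have "Max (range g) \<in> range g" by (intro Max_in) auto
    moreover have "sum m (- {}) \<ge> 0" using m by (intro sum_nonneg) (auto intro: less_imp_le)
    ultimately show ?thesis unfolding A_def mem_Collect_eq by (metis sum.empty)
  qed
  then have "A \<noteq> {}" by auto
  moreover have fin: "finite A" unfolding A_def by simp
  ultimately have c: "Min A \<in> A" by (intro Min_in)
  define c where "c = Min A"
  have "sum m {u. g u < c} \<le> sum m (- {u. g u < c})"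
  proof (rule ccontr)
    assume big: "\<not> ?thesis"
    have ne: "{u. g u < c} \<noteq> {}"
    proof
      assume "{u. g u < c} = {}"
      moreover have "sum m (- {}) \<ge> 0" using m by (intro sum_nonneg) (auto intro: less_imp_le)
      ultimately show False using big by (metis sum.empty)
    qed
    \<comment> \<open>The largest value of \<open>g\<close> below \<open>c\<close> would also belong to \<open>A\<close>.\<close>
    define c' where "c' = Max (g ` {u. g u < c})"
    have "c' \<in> g ` {u. g u < c}" unfolding c'_def using ne by (intro Max_in) auto
    then have c': "c' < c" "c' \<in> range g" by auto
    have "g u \<le> c'" if "g u < c" for u unfolding c'_def using that by (intro Max_ge) auto
    with c' have eq: "{u. g u > c'} = - {u. g u < c}" by force
    have "c' \<in> A" unfolding A_def using c' big by (simp add: eq)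
    then have "c \<le> c'" unfolding c_def using fin by simp
    with c' show False by simp
  qed
  with c show thesis by (intro that[of c]) (auto simp: A_def c_def)
qed

text \<open>
  Subtracting a median \<open>c\<close> of \<open>g\<close> gives positive and negative parts \<open>p\<close>, \<open>q\<close> that are each supported on at most half of the mass, so the isoperimetric
  hypothesis applies to all their level sets. As \<open>g\<close> is centred, the shift does not decrease the
  mass, and as \<open>k \<ge> 0\<close>, the split does not increase the energy. Hence \<open>p\<close> or \<open>q\<close> has Rayleigh quotient
  at most \<open>l\<close>.
\<close>

lemma cheeger_inequality:
  fixes k :: "'v::finite \<Rightarrow> 'v \<Rightarrow> real" and m g :: "'v \<Rightarrow> real"
  assumes sym: "\<And>u v. k u v = k v u" and nonneg: "\<And>u v. k u v \<ge> 0"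
    and degree: "\<And>u. (\<Sum>v\<in>UNIV. k u v) \<le> C * m u"
    and h: "h \<ge> 0"
    and iso: "\<And>T. T \<noteq> {} \<Longrightarrow> sum m T \<le> sum m (- T) \<Longrightarrow> h * sum m T \<le> cut_weight k T"
    and m: "\<And>u. m u > 0"
    and centred: "(\<Sum>u\<in>UNIV. m u * g u) = 0" and nonzero: "g z \<noteq> 0"
    and rayleigh: "dirichlet_form k g \<le> l * (\<Sum>u\<in>UNIV. m u * (g u)\<^sup>2)"
    and l: "l \<le> C"
  shows "h\<^sup>2 \<le> l * (2 * C - l)"
proof -
  obtain c where above: "sum m {u. g u > c} \<le> sum m (- {u. g u > c})"
    and below: "sum m {u. g u < c} \<le> sum m (- {u. g u < c})"
    by (rule weighted_median_exists[OF m])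
  define M where "M a = (\<Sum>u\<in>UNIV. m u * (a u)\<^sup>2)" for a :: "'v \<Rightarrow> real"
  define p where "p u = max (g u - c) 0" for u
  define q where "q u = max (c - g u) 0" for u
  have M0: "M a \<ge> 0" for a unfolding M_def using m by (intro sum_nonneg) (simp add: less_imp_le)
  have Mg: "M g > 0"
    unfolding M_def using m nonzero
    by (intro sum_pos2[where i = z]) (auto simp: less_imp_le)
  have "M p + M q = (\<Sum>u\<in>UNIV. m u * (g u)\<^sup>2 + (m u * c\<^sup>2 - 2 * c * (m u * g u)))"
    unfolding M_def sum.distrib[symmetric]
    by (intro sum.cong refl) (auto simp: p_def q_def max_def power2_eq_square algebra_simps)
  also have "\<dots> = M g + (\<Sum>u\<in>UNIV. m u * c\<^sup>2)"
    by (simp add: sum.distrib sum_subtractf M_def centred flip: sum_distrib_left)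
  also have "\<dots> \<ge> M g" using m by (simp add: sum_nonneg less_imp_le)
  finally have M_ge: "M g \<le> M p + M q" .
  have "dirichlet_form k p + dirichlet_form k q \<le> dirichlet_form k g"
    unfolding dirichlet_form_def add_divide_distrib[symmetric] sum.distrib[symmetric]
  proof (intro divide_right_mono sum_mono)
    fix u v
    \<comment> \<open>The cross terms \<open>2 p(u) q(v)\<close> dropped here are nonnegative.\<close>
    have diff: "g u - g v = (p u - p v) - (q u - q v)" by (simp add: p_def q_def max_def)
    have pq: "p x * q x = 0" for x by (auto simp: p_def q_def max_def)
    have "(g u - g v)\<^sup>2 = (p u - p v)\<^sup>2 + (q u - q v)\<^sup>2 + 2 * (p u * q v + p v * q u) 
        - 2 * (p u * q u) - 2 * (p v * q v)"
      unfolding diff by (simp add: power2_eq_square algebra_simps)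
    moreover have "p u * q v + p v * q u \<ge> 0" by (simp add: p_def q_def)
    ultimately have "(p u - p v)\<^sup>2 + (q u - q v)\<^sup>2 \<le> (g u - g v)\<^sup>2" by (simp add: pq)
    then show "k u v * (p u - p v)\<^sup>2 + k u v * (q u - q v)\<^sup>2 \<le> k u v * (g u - g v)\<^sup>2"
      using nonneg[of u v] by (simp add: mult_left_mono flip: distrib_left)
  qed simp
  then have D_le: "dirichlet_form k p + dirichlet_form k q \<le> l * M g"
    using rayleigh by (simp add: M_def)
  have l0: "l \<ge> 0"
  proof -
    have "0 \<le> dirichlet_form k g" by (rule dirichlet_form_nonneg[OF nonneg])
    also have "\<dots> \<le> l * M g" using rayleigh by (simp add: M_def)
    finally show ?thesis using Mg by (simp add: zero_le_mult_iff)
  qed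
  then have D_le': "dirichlet_form k p + dirichlet_form k q \<le> l * M p + l * M q"
    using D_le mult_left_mono[OF M_ge l0] by (simp add: algebra_simps)
  have conclude: ?thesis if D: "dirichlet_form k a \<le> l * M a" and Ma: "M a > 0" and a: "\<And>u. a u \<ge> 0"
    and half: "sum m {u. a u \<noteq> 0} \<le> sum m (- {u. a u \<noteq> 0})" for a
  proof -
    have "h * sum m T \<le> cut_weight k T" if T: "T \<noteq> {}" "T \<subseteq> {u. a u \<noteq> 0}" for T
    proof (rule iso[OF T(1)])
      have "sum m T \<le> sum m {u. a u \<noteq> 0}" using T m by (intro sum_mono2) (auto intro: less_imp_le)
      also note half
      also have "sum m (- {u. a u \<noteq> 0}) \<le> sum m (- T)" using T m by (intro sum_mono2) (auto intro: less_imp_le)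
      finally show "sum m T \<le> sum m (- T)" .
    qed
    then have "h\<^sup>2 * (M a)\<^sup>2 \<le> dirichlet_form k a * (2 * C * M a - dirichlet_form k a)"
      unfolding M_def
      by (intro cheeger_inequality_supported sym nonneg degree h a) (auto simp: m less_imp_le)
    also have "\<dots> \<le> (l * M a) * (2 * C * M a - l * M a)"
    proof -
      \<comment> \<open>\<open>x (2 C M - x)\<close> increases for \<open>x\<close> up to \<open>C M\<close>.\<close>
      have "l * M a \<le> C * M a" using l Ma by simp
      then have "0 \<le> (l * M a - dirichlet_form k a) * (2 * (C * M a) - l * M a - dirichlet_form k a)"
        using D by (intro mult_nonneg_nonneg) linarith+
      then show ?thesis by (simp add: algebra_simps)
    qed
    also have "\<dots> = l * (2 * C - l) * (M a)\<^sup>2" by (simp add: power2_eq_square algebra_simps)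
    finally show ?thesis using Ma by simp
  qed
  have supp: "{u. p u \<noteq> 0} = {u. g u > c}" "{u. q u \<noteq> 0} = {u. g u < c}"
    by (auto simp: p_def q_def max_def)
  have p0: "p u \<ge> 0" and q0: "q u \<ge> 0" for u by (simp_all add: p_def q_def)
  have zero: "dirichlet_form k a = 0" if "M a = 0" for a
  proof -
    have "\<forall>u\<in>UNIV. m u * (a u)\<^sup>2 = 0"
      using that m unfolding M_def by (subst (asm) sum_nonneg_eq_0_iff) (auto simp: less_imp_le)
    then have "a u = 0" for u using m[of u] by (auto dest: spec[of _ u])
    then show ?thesis by (simp add: dirichlet_form_def)
  qed
  show ?thesis
  proof (cases "M p > 0 \<and> dirichlet_form k p \<le> l * M p")
    case True
    then show ?thesis using above p0 by (intro conclude[of p]) (auto simp: supp)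
  next
    case False
    have Dq: "dirichlet_form k q \<le> l * M q"
    proof (cases "M p > 0")
      case True then show ?thesis using False D_le' by auto
    next
      case False
      then have "M p = 0" using M0[of p] by simp
      then show ?thesis using zero[of p] D_le' by simp
    qed
    have "M q > 0"
    proof (rule ccontr)
      assume "\<not> ?thesis"
      then have "M q = 0" using M0[of q] by simp
      then show False using zero[of q] M_ge Mg D_le' False by simp
    qed
    then show ?thesis using Dq below q0 by (intro conclude[of q]) (auto simp: supp)
  qed
qed

section \<open>Rerouting negative edges along positive paths\<close>

lemma sum_over_edges:
  fixes F :: "'v::finite set set" and f :: "'v \<Rightarrow> 'v \<Rightarrow> real"
  assumes F: "\<And>e. e \<in> F \<Longrightarrow> card e = 2" and sym: "\<And>u v. f u v = f v u"
  shows "(\<Sum>u\<in>UNIV. \<Sum>v\<in>UNIV. if {u, v} \<in> F then f u v else 0) = 2 * (\<Sum>e\<in>F. on_edge f e)"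
proof -
  let ?h = "\<lambda>z. {fst z, snd z}"
  have "(\<Sum>u\<in>UNIV. \<Sum>v\<in>UNIV. if {u, v} \<in> F then f u v else 0)
      = (\<Sum>z\<in>UNIV. if ?h z \<in> F then f (fst z) (snd z) else 0)"
    by (simp add: sum.cartesian_product case_prod_unfold)
  also have "\<dots> = (\<Sum>z\<in>{z. ?h z \<in> F}. f (fst z) (snd z))"
    by (rule sum.mono_neutral_cong_right) auto
  also have "\<dots> = (\<Sum>e\<in>F. \<Sum>z | z \<in> {z. ?h z \<in> F} \<and> ?h z = e. f (fst z) (snd z))"
    by (rule sum.group[symmetric]) auto
  also have "\<dots> = (\<Sum>e\<in>F. 2 * on_edge f e)"
  proof (rule sum.cong[OF refl])
    fix e assume e: "e \<in> F"
    then obtain a b where ab: "e = {a, b}" "a \<noteq> b" using F[OF e] by (auto simp: card_2_iff)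
    have "{z. z \<in> {z. ?h z \<in> F} \<and> ?h z = e} = {(a, b), (b, a)}"
    proof (rule set_eqI)
      fix z
      have "?h z = e \<longleftrightarrow> z \<in> {(a, b), (b, a)}" by (cases z) (simp add: ab(1) doubleton_eq_iff)
      then show "z \<in> {z. z \<in> {z. ?h z \<in> F} \<and> ?h z = e} \<longleftrightarrow> z \<in> {(a, b), (b, a)}"
        using e by blast
    qed
    then show "(\<Sum>z | z \<in> {z. ?h z \<in> F} \<and> ?h z = e. f (fst z) (snd z)) = 2 * on_edge f e"
      using ab sym[of a b] by (simp add: on_edge_doubleton)
  qed
  finally show ?thesis by (simp add: sum_distrib_left)
qed

lemma sum_over_edge_boundary:
  fixes F :: "'v::finite set set" and f :: "'v \<Rightarrow> 'v \<Rightarrow> real"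
  assumes sym: "\<And>u v. f u v = f v u"
  shows "(\<Sum>e\<in>edge_boundary F S. on_edge f e) = cut_weight (\<lambda>u v. if {u, v} \<in> F then f u v else 0) S"
proof -
  let ?A = "{z \<in> S \<times> - S. {fst z, snd z} \<in> F}"
  have "bij_betw (\<lambda>z. {fst z, snd z}) ?A (edge_boundary F S)"
    unfolding bij_betw_def
  proof
    show "inj_on (\<lambda>z. {fst z, snd z}) ?A" by (auto simp: inj_on_def doubleton_eq_iff)
    show "(\<lambda>z. {fst z, snd z}) ` ?A = edge_boundary F S"
    proof (rule set_eqI)
      fix e
      have "e \<in> edge_boundary F S \<longleftrightarrow> (\<exists>u v. e = {u, v} \<and> {u, v} \<in> F \<and> u \<in> S \<and> v \<notin> S)"
        by (simp add: edge_boundary_def)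
      then show "e \<in> (\<lambda>z. {fst z, snd z}) ` ?A \<longleftrightarrow> e \<in> edge_boundary F S"
        by (auto simp: image_iff)
    qed
  qed
  then have "(\<Sum>e\<in>edge_boundary F S. on_edge f e) = (\<Sum>z\<in>?A. on_edge f {fst z, snd z})"
    by (rule sum.reindex_bij_betw[symmetric])
  also have "\<dots> = (\<Sum>z\<in>?A. f (fst z) (snd z))"
    by (simp add: on_edge_doubleton sym)
  also have "\<dots> = (\<Sum>z\<in>S \<times> - S. if {fst z, snd z} \<in> F then f (fst z) (snd z) else 0)"
    by (rule sum.mono_neutral_cong_left) auto
  finally show ?thesis
    by (simp add: cut_weight_def sum.cartesian_product case_prod_unfold)
qed

lemma mem_pos_edges:
  assumes "\<And>u v. w u v = w v u"
  shows "{u, v} \<in> pos_edges E w \<longleftrightarrow> {u, v} \<in> E \<and> w u v > 0"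
  unfolding pos_edges_def by (auto simp: doubleton_eq_iff insert_commute[of v u] assms[of v u])

lemma mem_neg_edges:
  assumes "\<And>u v. w u v = w v u"
  shows "{u, v} \<in> neg_edges E w \<longleftrightarrow> {u, v} \<in> E \<and> w u v < 0"
  unfolding neg_edges_def by (auto simp: doubleton_eq_iff insert_commute[of v u] assms[of v u])

text \<open>
  The difference \<open>g x - g y\<close> telescopes along the path, and Cauchy-Schwarz costs a factor equal to
  the number of edges. Distinctness of the vertices is what identifies the edge set with the
  sequence of steps: without it, an edge that is traversed twice would be counted once.
\<close>

lemma path_poincare_inequality:
  fixes g :: "'v \<Rightarrow> real"
  assumes p: "p \<in> paths F x y"
  shows "(g x - g y)\<^sup>2 \<le> real (card p) * (\<Sum>e\<in>p. on_edge (\<lambda>u v. (g u - g v)\<^sup>2) e)"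
proof -
  obtain xs where xs: "p = list_edges xs" "xs \<noteq> []" "distinct xs" "hd xs = x" "last xs = y"
    using p by (auto simp: paths_def)
  define n where "n = length xs - 1"
  let ?s = "\<lambda>i. {xs ! i, xs ! Suc i}"
  have Suc_less: "Suc i < length xs \<longleftrightarrow> i < n" for i by (auto simp: n_def)
  have p_image: "p = ?s ` {..<n}" by (auto simp: xs(1) list_edges_def Suc_less)
  have inj: "inj_on ?s {..<n}"
  proof (rule inj_onI)
    fix i j assume ij: "i \<in> {..<n}" "j \<in> {..<n}" and eq: "?s i = ?s j"
    then have "Suc i < length xs" "Suc j < length xs" by (auto simp: Suc_less)
    then show "i = j" using eq xs(3) by (auto simp: doubleton_eq_iff nth_eq_iff_index_eq)
  qed
  have card: "card p = n" by (simp add: p_image card_image inj)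
  have "g x - g y = - (\<Sum>i<n. g (xs ! Suc i) - g (xs ! i))"
    using xs(2) by (subst sum_lessThan_telescope)
      (simp add: n_def hd_conv_nth last_conv_nth flip: xs(4,5))
  then have "(g x - g y)\<^sup>2 = (\<Sum>i<n. g (xs ! Suc i) - g (xs ! i))\<^sup>2" by simp
  also have "\<dots> \<le> (\<Sum>i<n. (g (xs ! Suc i) - g (xs ! i))\<^sup>2) * real (card {..<n})"
    by (rule sum_squared_le_sum_of_squares)
  also have "(\<Sum>i<n. (g (xs ! Suc i) - g (xs ! i))\<^sup>2) = (\<Sum>e\<in>p. on_edge (\<lambda>u v. (g u - g v)\<^sup>2) e)"
    by (simp add: p_image sum.reindex[OF inj] on_edge_doubleton power2_commute)
  finally show ?thesis by (simp add: card mult.commute)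
qed

text \<open>
  Extending the routed weights by 0 to all pairs of vertices turns sums over edges into double sums
  over vertices.
\<close>

definition routed_kernel ::
    "'v set set \<Rightarrow> ('v \<Rightarrow> 'v \<Rightarrow> real) \<Rightarrow> ('v \<Rightarrow> real) \<Rightarrow> ('v set set \<Rightarrow> real) \<Rightarrow> 'v \<Rightarrow> 'v \<Rightarrow> real" where
  "routed_kernel E w \<phi> \<alpha> u v = (if {u, v} \<in> pos_edges E w then routed_weight E w \<phi> \<alpha> u v else 0)"

lemma sum_edge_boundary_routed_weight:
  fixes E :: "'v::finite set set"
  assumes "\<And>u v. w u v = w v u"
  shows "(\<Sum>e\<in>edge_boundary (pos_edges E w) S. on_edge (routed_weight E w \<phi> \<alpha>) e)
      = cut_weight (routed_kernel E w \<phi> \<alpha>) S"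
  unfolding routed_kernel_def[abs_def]
  by (rule sum_over_edge_boundary) (rule routed_weight_commute[OF assms])

lemma path_subset: "p \<in> paths F x y \<Longrightarrow> p \<subseteq> F"
  by (auto simp: paths_def)

text \<open>
  A negative edge \<open>{x, y}\<close> contributes \<open>- \<bar>w x y\<bar> \<phi> x \<phi> y (g x - g y)\<^sup>2\<close> to the form on the right.
  Splitting it among the paths from \<open>x\<close> to \<open>y\<close> in the proportions \<open>\<alpha> p\<close> and applying the Poincare
  inequality along each path bounds the loss by a sum over positive edges. Summed over all negative
  edges, this is exactly what the routed weight subtracts from \<open>w u v \<phi> u \<phi> v\<close>.
\<close>

lemma dirichlet_form_routed_le:
  fixes E :: "'v::finite set set" and w :: "'v \<Rightarrow> 'v \<Rightarrow> real" and \<phi> g :: "'v \<Rightarrow> real"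
  assumes E: "\<And>e. e \<in> E \<Longrightarrow> card e = 2"
    and sym: "\<And>u v. w u v = w v u"
    and support: "\<And>u v. w u v \<noteq> 0 \<Longrightarrow> {u, v} \<in> E"
    and \<phi>: "\<And>u. \<phi> u \<ge> 0"
    and routing: "routing E w \<alpha>"
  shows "dirichlet_form (routed_kernel E w \<phi> \<alpha>) g \<le> dirichlet_form (\<lambda>u v. w u v * \<phi> u * \<phi> v) g"
proof -
  define P where "P = pos_edges E w"
  define N where "N = neg_edges E w"
  define sq where "sq u v = (g u - g v)\<^sup>2" for u v
  define A where "A u v = w u v * \<phi> u * \<phi> v" for u v
  \<comment> \<open>The load that the negative edge \<open>n\<close> puts on the positive edge \<open>e\<close>.\<close>
  define R where "R n e = on_edge (\<lambda>x y. \<Sum>p | p \<in> paths P x y \<and> e \<in> p.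
          \<bar>w x y\<bar> * real (card p) * \<alpha> p * \<phi> x * \<phi> y) n" for n e
  have sq_sym: "sq u v = sq v u" for u v by (simp add: sq_def power2_commute)
  have A_sym: "A u v = A v u" for u v by (simp add: A_def sym mult_ac)
  have rw: "routed_weight E w \<phi> \<alpha> u v = A u v - (\<Sum>n\<in>N. R n {u, v})" for u v
    by (simp add: routed_weight_def A_def R_def N_def P_def)
  have rw_sym: "routed_weight E w \<phi> \<alpha> u v = routed_weight E w \<phi> \<alpha> v u" for u v
    by (rule routed_weight_commute[OF sym])
  have P_card: "card e = 2" if "e \<in> P" for e using that E by (auto simp: P_def pos_edges_def)
  have N_card: "card e = 2" if "e \<in> N" for e using that E by (auto simp: N_def neg_edges_def)
  have "(\<Sum>u\<in>UNIV. \<Sum>v\<in>UNIV. routed_kernel E w \<phi> \<alpha> u v * (g u - g v)\<^sup>2)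
      = (\<Sum>u\<in>UNIV. \<Sum>v\<in>UNIV. if {u, v} \<in> P then routed_weight E w \<phi> \<alpha> u v * sq u v else 0)"
    by (intro sum.cong refl) (simp add: routed_kernel_def sq_def P_def)
  also have "\<dots> = 2 * (\<Sum>e\<in>P. on_edge (\<lambda>u v. routed_weight E w \<phi> \<alpha> u v * sq u v) e)"
    by (rule sum_over_edges[OF P_card]) (simp_all add: rw_sym sq_sym)
  also have "(\<Sum>e\<in>P. on_edge (\<lambda>u v. routed_weight E w \<phi> \<alpha> u v * sq u v) e)
      = (\<Sum>e\<in>P. on_edge (\<lambda>u v. A u v * sq u v) e - (\<Sum>n\<in>N. R n e * on_edge sq e))"
  proof (rule sum.cong[OF refl])
    fix e assume "e \<in> P"
    then obtain u v where e: "e = {u, v}" by (auto simp: P_def pos_edges_def)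
    have "on_edge (\<lambda>u v. routed_weight E w \<phi> \<alpha> u v * sq u v) e = routed_weight E w \<phi> \<alpha> u v * sq u v"
      unfolding e by (rule on_edge_doubleton) (simp add: rw_sym[of u v] sq_sym[of u v])
    moreover have "on_edge (\<lambda>u v. A u v * sq u v) e = A u v * sq u v"
      unfolding e by (rule on_edge_doubleton) (simp add: A_sym[of u v] sq_sym[of u v])
    moreover have "on_edge sq e = sq u v"
      unfolding e by (rule on_edge_doubleton) (rule sq_sym)
    ultimately show "on_edge (\<lambda>u v. routed_weight E w \<phi> \<alpha> u v * sq u v) e
      = on_edge (\<lambda>u v. A u v * sq u v) e - (\<Sum>n\<in>N. R n e * on_edge sq e)"
      by (simp add: rw e left_diff_distrib sum_distrib_right)
  qed
  also have "\<dots> = (\<Sum>e\<in>P. on_edge (\<lambda>u v. A u v * sq u v) e) - (\<Sum>n\<in>N. \<Sum>e\<in>P. R n e * on_edge sq e)"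
    by (simp add: sum_subtractf sum.swap[of _ N P])
  also have "\<dots> \<le> (\<Sum>e\<in>P. on_edge (\<lambda>u v. A u v * sq u v) e) + (\<Sum>n\<in>N. on_edge (\<lambda>u v. A u v * sq u v) n)"
  proof -
    have "- on_edge (\<lambda>u v. A u v * sq u v) n \<le> (\<Sum>e\<in>P. R n e * on_edge sq e)" if n_in: "n \<in> N" for n
    proof -
      obtain x y where n: "n = {x, y}" and xy: "{x, y} \<in> E" "w x y < 0"
        using n_in unfolding N_def neg_edges_def by blast
      define c where "c = \<bar>w x y\<bar> * \<phi> x * \<phi> y"
      have c: "c \<ge> 0" by (simp add: c_def \<phi>)
      have R: "R n e = (\<Sum>p | p \<in> paths P x y \<and> e \<in> p. c * (\<alpha> p * real (card p)))" for e
        unfolding R_def n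
        by (subst on_edge_doubleton)
           (simp_all add: c_def mult_ac sym[of y x] paths_commute[of P y x])
      have \<alpha>: "\<alpha> p \<ge> 0" if "p \<in> paths P x y" for p
        using routing xy that by (auto simp: routing_def P_def less_imp_le)
      have \<alpha>_sum: "(\<Sum>p\<in>paths P x y. \<alpha> p) = 1"
        using routing xy by (auto simp: routing_def P_def)
      have "- on_edge (\<lambda>u v. A u v * sq u v) n = c * sq x y"
        unfolding n using xy
        by (subst on_edge_doubleton) (simp_all add: A_sym[of x y] sq_sym[of x y], simp_all add: c_def A_def sym[of y x])
      also have "\<dots> = (\<Sum>p\<in>paths P x y. c * (\<alpha> p * sq x y))"
        by (simp add: \<alpha>_sum flip: sum_distrib_left sum_distrib_right)
      also have "\<dots> \<le> (\<Sum>p\<in>paths P x y. c * (\<alpha> p * (real (card p) * (\<Sum>e\<in>p. on_edge sq e))))"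
      proof (intro sum_mono mult_left_mono c \<alpha>)
        fix p assume "p \<in> paths P x y"
        then show "sq x y \<le> real (card p) * (\<Sum>e\<in>p. on_edge sq e)"
          unfolding sq_def[abs_def] by (rule path_poincare_inequality)
      qed
      also have "\<dots> = (\<Sum>p\<in>paths P x y. \<Sum>e\<in>P. if e \<in> p then c * (\<alpha> p * real (card p)) * on_edge sq e else 0)"
      proof (rule sum.cong[OF refl])
        fix p assume "p \<in> paths P x y"
        then have "(\<Sum>e\<in>P. if e \<in> p then c * (\<alpha> p * real (card p)) * on_edge sq e else 0)
            = (\<Sum>e\<in>p. c * (\<alpha> p * real (card p)) * on_edge sq e)"
          using path_subset[of p P x y] by (intro sum.mono_neutral_cong_right) auto
        then show "c * (\<alpha> p * (real (card p) * (\<Sum>e\<in>p. on_edge sq e)))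
            = (\<Sum>e\<in>P. if e \<in> p then c * (\<alpha> p * real (card p)) * on_edge sq e else 0)"
          by (simp add: sum_distrib_left mult.assoc)
      qed
      also have "\<dots> = (\<Sum>e\<in>P. \<Sum>p\<in>paths P x y. if e \<in> p then c * (\<alpha> p * real (card p)) * on_edge sq e else 0)"
        by (rule sum.swap)
      also have "\<dots> = (\<Sum>e\<in>P. R n e * on_edge sq e)"
        unfolding R sum_distrib_right
        by (intro sum.cong refl sum.mono_neutral_cong_right) auto
      finally show ?thesis .
    qed
    then have "(\<Sum>n\<in>N. - on_edge (\<lambda>u v. A u v * sq u v) n) \<le> (\<Sum>n\<in>N. \<Sum>e\<in>P. R n e * on_edge sq e)"
      by (rule sum_mono)
    then show ?thesis by (simp add: sum_negf)
  qed
  also have "2 * \<dots> = (\<Sum>u\<in>UNIV. \<Sum>v\<in>UNIV. if {u, v} \<in> P then A u v * sq u v else 0)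
      + (\<Sum>u\<in>UNIV. \<Sum>v\<in>UNIV. if {u, v} \<in> N then A u v * sq u v else 0)"
    by (subst sum_over_edges[OF P_card] sum_over_edges[OF N_card], simp, simp add: A_sym sq_sym)+ simp
  also have "\<dots> = (\<Sum>u\<in>UNIV. \<Sum>v\<in>UNIV. w u v * \<phi> u * \<phi> v * (g u - g v)\<^sup>2)"
    unfolding sum.distrib[symmetric]
  proof (intro sum.cong refl)
    fix u v
    show "(if {u, v} \<in> P then A u v * sq u v else 0) + (if {u, v} \<in> N then A u v * sq u v else 0)
       = w u v * \<phi> u * \<phi> v * (g u - g v)\<^sup>2"
      using support[of u v]
      by (auto simp: P_def N_def mem_pos_edges[OF sym] mem_neg_edges[OF sym] A_def sq_def)
  qed
  finally show ?thesis by (simp add: dirichlet_form_def)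
qed

section \<open>Eigenvalues of symmetric matrices\<close>

lemma mat_mult_vec: "mat c *v x = c *\<^sub>R (x :: real^'n::finite)"
  by (simp add: vec_eq_iff matrix_vector_mult_def mat_def if_distrib[of "\<lambda>z. z * _"] cong: if_cong)

lemma ordered_eigenvalues_iff:
  fixes A :: "real^'v^'v::finite"
  assumes "ordered_eigenvalues A lam"
  shows "(\<exists>x. x \<noteq> 0 \<and> A *v x = c *\<^sub>R x) \<longleftrightarrow> (\<exists>i<CARD('v). lam i = c)"
proof -
  have "(\<exists>i<CARD('v). lam i = c) \<longleftrightarrow> det (mat c - A) = 0"
    using assms by (auto simp: ordered_eigenvalues_def)
  also have "\<dots> \<longleftrightarrow> (\<exists>x. x \<noteq> 0 \<and> (mat c - A) *v x = 0)"
    using invertible_det_nz[of "mat c - A"] invertible_left_inverse[of "mat c - A"]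
      matrix_left_invertible_ker[of "mat c - A"] by auto
  also have "\<dots> \<longleftrightarrow> (\<exists>x. x \<noteq> 0 \<and> A *v x = c *\<^sub>R x)"
    by (auto simp: matrix_vector_mult_diff_rdistrib mat_mult_vec)
  finally show ?thesis by simp
qed

lemma symmetric_matrix_inner:
  fixes A :: "real^'n^'n::finite"
  assumes "transpose A = A"
  shows "(A *v x) \<bullet> y = x \<bullet> (A *v y)"
  using assms by (metis dot_lmul_matrix vector_transpose_matrix)

text \<open>
  A maximiser of the quadratic form on the unit sphere, which exists by compactness, is an
  eigenvector.
\<close>

lemma rayleigh_quotient_attained:
  fixes A :: "real^'n^'n::finite"
  assumes sym: "transpose A = A"
  obtains c y where "y \<noteq> 0" "A *v y = c *\<^sub>R y" "\<And>x. x \<bullet> (A *v x) \<le> c * (x \<bullet> x)"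
proof -
  have "\<exists>y\<in>sphere 0 1. \<forall>x\<in>sphere 0 1. x \<bullet> (A *v x) \<le> y \<bullet> (A *v y)"
  proof (rule continuous_attains_sup)
    show "(sphere 0 1 :: (real^'n) set) \<noteq> {}"
      using norm_axis_1[of "undefined :: 'n"] by force
    show "continuous_on (sphere 0 1) (\<lambda>x. x \<bullet> (A *v x))"
      by (intro continuous_intros matrix_vector_mult_linear_continuous_on)
  qed simp
  then obtain y where y: "norm y = 1" and max: "\<And>x. norm x = 1 \<Longrightarrow> x \<bullet> (A *v x) \<le> y \<bullet> (A *v y)"
    by auto
  define c where "c = y \<bullet> (A *v y)"
  have bound: "x \<bullet> (A *v x) \<le> c * (x \<bullet> x)" for x
  proof (cases "x = 0")
    case False
    then have "(x /\<^sub>R norm x) \<bullet> (A *v (x /\<^sub>R norm x)) \<le> c" unfolding c_def by (intro max) simp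
    then have "(x \<bullet> (A *v x)) / (norm x)\<^sup>2 \<le> c"
      by (simp add: matrix_vector_mult_scaleR power2_eq_square divide_inverse mult_ac)
    then show ?thesis using False by (simp add: divide_le_eq power2_norm_eq_inner)
  qed simp
  define q where "q x = c * (x \<bullet> x) - x \<bullet> (A *v x)" for x
  define r where "r = c *\<^sub>R y - A *v y"
  have q0: "q x \<ge> 0" for x using bound by (simp add: q_def)
  have "y \<bullet> y = 1" using y by (simp flip: power2_norm_eq_inner)
  then have qy: "q y = 0" by (simp add: q_def c_def)
  \<comment> \<open>Since \<open>q\<close> is minimal at \<open>y\<close>, its derivative in the direction of the residual \<open>r\<close> vanishes.\<close>
  have expand: "q (y + t *\<^sub>R r) = 2 * t * (r \<bullet> r) + t\<^sup>2 * q r" for t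
  proof -
    have "q (y + t *\<^sub>R r) = q y + 2 * t * (c * (y \<bullet> r) - (A *v y) \<bullet> r) + t\<^sup>2 * q r"
      using symmetric_matrix_inner[OF sym, of y r]
      by (simp add: q_def matrix_vector_right_distrib matrix_vector_mult_scaleR inner_add_left
          inner_add_right inner_commute power2_eq_square algebra_simps)
    also have "c * (y \<bullet> r) - (A *v y) \<bullet> r = r \<bullet> r"
      by (simp add: r_def inner_diff_left)
    finally show ?thesis using qy by simp
  qed
  have "r \<bullet> r = 0"
  proof (rule ccontr)
    assume "r \<bullet> r \<noteq> 0"
    then have rr: "r \<bullet> r > 0" by simp
    \<comment> \<open>A small negative step makes the linear term dominate; the 1 keeps the denominator positive.\<close>
    define t where "t = - (r \<bullet> r) / (q r + 1)"
    have t: "t < 0" using rr q0[of r] by (simp add: t_def divide_neg_pos)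
    have "0 \<le> 2 * t * (r \<bullet> r) + t\<^sup>2 * q r" using q0[of "y + t *\<^sub>R r"] expand by simp
    also have "\<dots> = t * (2 * (r \<bullet> r) + t * q r)" by (simp add: power2_eq_square algebra_simps)
    finally have "2 * (r \<bullet> r) + t * q r \<le> 0" using t by (simp add: zero_le_mult_iff)
    moreover have "- t * q r \<le> r \<bullet> r"
      using q0[of r] rr by (simp add: t_def divide_le_eq field_simps)
    ultimately show False using rr by simp
  qed
  then have "A *v y = c *\<^sub>R y" by (simp add: r_def)
  moreover have "y \<noteq> 0" using y by auto
  ultimately show thesis using bound that by blast
qed

lemma rayleigh_le_largest_eigenvalue:
  fixes A :: "real^'v^'v::finite"
  assumes sym: "transpose A = A" and eig: "ordered_eigenvalues A lam"
  shows "x \<bullet> (A *v x) \<le> lam (CARD('v) - 1) * (x \<bullet> x)"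
proof -
  obtain c y where y: "y \<noteq> 0" "A *v y = c *\<^sub>R y" and c: "x \<bullet> (A *v x) \<le> c * (x \<bullet> x)"
    using rayleigh_quotient_attained[OF sym] by metis
  obtain i where "i < CARD('v)" "lam i = c"
    using ordered_eigenvalues_iff[OF eig, of c] y by blast
  then have "c \<le> lam (CARD('v) - 1)"
    using eig by (auto simp: ordered_eigenvalues_def)
  then show ?thesis using c by (meson inner_ge_zero mult_right_mono order_trans)
qed

section \<open>The ground-state transform\<close>

definition schrodinger_matrix :: "('v::finite \<Rightarrow> 'v \<Rightarrow> real) \<Rightarrow> ('v \<Rightarrow> real) \<Rightarrow> real^'v^'v" where
  "schrodinger_matrix w W = normalized_laplacian w + diagonal_matrix W"

text \<open>
  Multiplication by the ground-state eigenvector, whose entries are \<open>sqrt (deg w u) * \<phi> u\<close>. It carries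
  the mass \<open>deg w u * (\<phi> u)\<^sup>2\<close> on vertices to the Euclidean inner product.
\<close>

definition ground_lift ::
    "('v::finite \<Rightarrow> 'v \<Rightarrow> real) \<Rightarrow> ('v \<Rightarrow> real) \<Rightarrow> ('v \<Rightarrow> real) \<Rightarrow> real^'v" where
  "ground_lift w \<phi> g = (\<chi> u. sqrt (deg w u) * \<phi> u * g u)"

lemma transpose_schrodinger_matrix:
  assumes "\<And>u v. w u v = w v u"
  shows "transpose (schrodinger_matrix w W) = schrodinger_matrix w W"
  using assms
  by (auto simp: vec_eq_iff transpose_def schrodinger_matrix_def normalized_laplacian_def
      diagonal_matrix_def mult.commute)

lemma inner_ground_lift:
  assumes "\<And>u. deg w u > 0"
  shows "ground_lift w \<phi> g \<bullet> ground_lift w \<phi> g' = (\<Sum>u\<in>UNIV. deg w u * (\<phi> u)\<^sup>2 * (g u * g' u))"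
proof -
  have "sqrt (deg w u) * \<phi> u * g u * (sqrt (deg w u) * \<phi> u * g' u) = deg w u * (\<phi> u)\<^sup>2 * (g u * g' u)" for u
  proof -
    have "sqrt (deg w u) * \<phi> u * g u * (sqrt (deg w u) * \<phi> u * g' u)
        = (sqrt (deg w u) * sqrt (deg w u)) * (\<phi> u)\<^sup>2 * (g u * g' u)"
      by (simp only: power2_eq_square mult_ac)
    then show ?thesis using assms[of u] by simp
  qed
  then show ?thesis by (simp only: inner_vec_def ground_lift_def vec_lambda_beta inner_real_def)
qed

lemma schrodinger_matrix_ground_lift:
  assumes d: "\<And>u. deg w u > 0" and diag: "\<And>u. w u u = 0" 
  shows "(schrodinger_matrix w W *v ground_lift w \<phi> g) $ u
     = (1 + W u) * (sqrt (deg w u) * \<phi> u * g u) - (\<Sum>v\<in>UNIV. w u v * \<phi> v * g v) / sqrt (deg w u)"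
proof -
  have "(if u = v then 1 else - w u v / sqrt (deg w u * deg w v)) + (if u = v then W u else 0)
      = (if u = v then 1 + W u else 0) - w u v / (sqrt (deg w u) * sqrt (deg w v))" for v
    by (simp add: diag real_sqrt_mult)
  moreover have "w u v / (sqrt (deg w u) * sqrt (deg w v)) * (sqrt (deg w v) * \<phi> v * g v)
      = w u v * \<phi> v * g v / sqrt (deg w u)" for v
    using d[of v] by simp
  ultimately show ?thesis
    by (simp add: schrodinger_matrix_def normalized_laplacian_def diagonal_matrix_def ground_lift_def
        matrix_vector_mult_def left_diff_distrib sum_subtractf sum_divide_distrib
        if_distrib[of "\<lambda>z. z * _"] cong: if_cong)
qed

lemma ground_state_sum:
  assumes "ground_state w W \<mu> \<phi>"
  shows "(\<Sum>v\<in>UNIV. w u v * \<phi> v) = (1 + W u - \<mu>) * deg w u * \<phi> u"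
proof -
  have "(\<mu> - W u) * deg w u * \<phi> u = (\<Sum>v\<in>UNIV. w u v * (\<phi> u - \<phi> v))"
    using assms by (simp add: ground_state_def)
  also have "\<dots> = deg w u * \<phi> u - (\<Sum>v\<in>UNIV. w u v * \<phi> v)"
    by (simp add: deg_def right_diff_distrib sum_subtractf sum_distrib_right)
  finally show ?thesis by (simp add: algebra_simps)
qed

lemma ground_state_eigenvector:
  assumes d: "\<And>u. deg w u > 0" and diag: "\<And>u. w u u = 0" and gs: "ground_state w W \<mu> \<phi>"
  shows "schrodinger_matrix w W *v ground_lift w \<phi> (\<lambda>_. 1) = \<mu> *\<^sub>R ground_lift w \<phi> (\<lambda>_. 1)"
proof -
  have "(1 + W u - \<mu>) * deg w u * \<phi> u / sqrt (deg w u) = (1 + W u - \<mu>) * (sqrt (deg w u) * \<phi> u)" for u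
    using d[of u] by (simp add: field_simps)
  then show ?thesis
    by (simp add: vec_eq_iff schrodinger_matrix_ground_lift[OF d diag] ground_state_sum[OF gs])
       (simp add: ground_lift_def algebra_simps)
qed

text \<open>
  Expanding the matrix product, the diagonal term \<open>1 + W u - \<mu>\<close> is replaced by an average of
  neighbours through the ground-state equation \<open>(1 + W u - \<mu>) d\<^sub>u \<phi> u = \<Sum>v. w u v \<phi> v\<close>. The potential
  cancels, and what remains is \<open>\<Sum>u v. w u v \<phi> u \<phi> v (g u\<^sup>2 - g u g v)\<close>, which becomes the Dirichlet form
  after symmetrisation.
\<close>

lemma ground_state_transform:
  assumes sym: "\<And>u v. w u v = w v u"
    and d: "\<And>u. deg w u > 0" and diag: "\<And>u. w u u = 0" and gs: "ground_state w W \<mu> \<phi>"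
  shows "ground_lift w \<phi> g \<bullet> (schrodinger_matrix w W *v ground_lift w \<phi> g)
      - \<mu> * (ground_lift w \<phi> g \<bullet> ground_lift w \<phi> g)
    = dirichlet_form (\<lambda>u v. w u v * \<phi> u * \<phi> v) g"
proof -
  let ?A = "\<lambda>u v. w u v * \<phi> u * \<phi> v"
  have pointwise: "ground_lift w \<phi> g $ u * (schrodinger_matrix w W *v ground_lift w \<phi> g) $ u
      - \<mu> * (deg w u * (\<phi> u)\<^sup>2 * (g u * g u)) = (\<Sum>v\<in>UNIV. ?A u v * (g u)\<^sup>2) - (\<Sum>v\<in>UNIV. ?A u v * (g u * g v))" for u
  proof -
    define s where "s = sqrt (deg w u)"
    have s: "s > 0" and ss: "deg w u = s * s" using d[of u] by (simp_all add: s_def)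
    have "ground_lift w \<phi> g $ u * (schrodinger_matrix w W *v ground_lift w \<phi> g) $ u
      = s * \<phi> u * g u * ((1 + W u) * (s * \<phi> u * g u) - (\<Sum>v\<in>UNIV. w u v * \<phi> v * g v) / s)"
      by (simp add: schrodinger_matrix_ground_lift[OF d diag]) (simp add: ground_lift_def s_def)
    also have "\<dots> = (1 + W u) * deg w u * (\<phi> u)\<^sup>2 * (g u)\<^sup>2 - \<phi> u * g u * (\<Sum>v\<in>UNIV. w u v * \<phi> v * g v)"
      using s by (simp add: ss field_simps power2_eq_square)
    finally have "ground_lift w \<phi> g $ u * (schrodinger_matrix w W *v ground_lift w \<phi> g) $ u
        - \<mu> * (deg w u * (\<phi> u)\<^sup>2 * (g u * g u))
      = \<phi> u * (g u)\<^sup>2 * ((1 + W u - \<mu>) * deg w u * \<phi> u) - \<phi> u * g u * (\<Sum>v\<in>UNIV. w u v * \<phi> v * g v)"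
      by (simp add: algebra_simps power2_eq_square)
    also have "\<dots> = (\<Sum>v\<in>UNIV. ?A u v * (g u)\<^sup>2) - (\<Sum>v\<in>UNIV. ?A u v * (g u * g v))"
      unfolding ground_state_sum[OF gs, symmetric] by (simp add: sum_distrib_left mult_ac)
    finally show ?thesis .
  qed
  have swap: "(\<Sum>u\<in>UNIV. \<Sum>v\<in>UNIV. ?A u v * (g v)\<^sup>2) = (\<Sum>u\<in>UNIV. \<Sum>v\<in>UNIV. ?A u v * (g u)\<^sup>2)"
    by (subst sum.swap, intro sum.cong refl) (simp add: sym mult_ac)
  have "(\<Sum>u\<in>UNIV. \<Sum>v\<in>UNIV. ?A u v * (g u - g v)\<^sup>2)
      = (\<Sum>u\<in>UNIV. \<Sum>v\<in>UNIV. ?A u v * (g u)\<^sup>2 + ?A u v * (g v)\<^sup>2 - 2 * (?A u v * (g u * g v)))"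
    by (intro sum.cong refl) (simp add: power2_eq_square algebra_simps)
  also have "\<dots> = 2 * ((\<Sum>u\<in>UNIV. \<Sum>v\<in>UNIV. ?A u v * (g u)\<^sup>2) - (\<Sum>u\<in>UNIV. \<Sum>v\<in>UNIV. ?A u v * (g u * g v)))"
    by (simp add: sum.distrib sum_subtractf swap flip: sum_distrib_left)
  finally have "dirichlet_form ?A g = (\<Sum>u\<in>UNIV. \<Sum>v\<in>UNIV. ?A u v * (g u)\<^sup>2) - (\<Sum>u\<in>UNIV. \<Sum>v\<in>UNIV. ?A u v * (g u * g v))"
    by (simp add: dirichlet_form_def)
  also have "\<dots> = (\<Sum>u\<in>UNIV. ground_lift w \<phi> g $ u * (schrodinger_matrix w W *v ground_lift w \<phi> g) $ u
      - \<mu> * (deg w u * (\<phi> u)\<^sup>2 * (g u * g u)))"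
    unfolding pointwise by (simp add: sum_subtractf)
  also have "\<dots> = ground_lift w \<phi> g \<bullet> (schrodinger_matrix w W *v ground_lift w \<phi> g)
      - \<mu> * (ground_lift w \<phi> g \<bullet> ground_lift w \<phi> g)"
    unfolding inner_ground_lift[OF d] by (simp add: inner_vec_def sum_subtractf sum_distrib_left)
  finally show ?thesis by simp
qed

section \<open>Admissible routings\<close>

lemma routed_weight_le:
  assumes \<phi>: "\<And>u. \<phi> u \<ge> 0" and sym: "\<And>u v. w u v = w v u" and routing: "routing E w \<alpha>"
  shows "routed_weight E w \<phi> \<alpha> u v \<le> w u v * \<phi> u * \<phi> v"
proof -
  have "on_edge (\<lambda>x y. \<Sum>p | p \<in> paths (pos_edges E w) x y \<and> {u, v} \<in> p.
      \<bar>w x y\<bar> * real (card p) * \<alpha> p * \<phi> x * \<phi> y) e \<ge> 0" if e: "e \<in> neg_edges E w" for e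
  proof -
    obtain x y where xy: "e = {x, y}" "{x, y} \<in> E" using e by (auto simp: neg_edges_def)
    have "\<alpha> p \<ge> 0" if "p \<in> paths (pos_edges E w) x y" for p
      using routing xy that by (auto simp: routing_def less_imp_le)
    then show ?thesis
      unfolding xy(1) on_edge_route_sum[OF sym]
      by (intro sum_nonneg mult_nonneg_nonneg \<phi>) auto
  qed
  then show ?thesis by (simp add: routed_weight_def sum_nonneg)
qed

lemma exists_other:
  assumes "CARD('v::finite) \<ge> 2"
  shows "\<exists>v. v \<noteq> (u :: 'v)"
proof (rule ccontr)
  assume "\<not> ?thesis"
  then have "(UNIV :: 'v set) = {u}" by auto
  then have "CARD('v) = card {u}" by (rule arg_cong)
  then show False using assms by simp
qed

text \<open>
  Every vertex is an end point of some positive edge \<open>{u, z}\<close>, by connectedness, and admissibility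
  gives \<open>0 < \<omega> u z \<le> w u z \<phi> u \<phi> z\<close>. Positivity thus comes from the routing and not from a
  Perron-Frobenius argument, which negative weights would obstruct.
\<close>

lemma ground_state_positive:
  fixes E :: "'v::finite set set"
  assumes \<phi>: "\<And>u. \<phi> u \<ge> 0" and sym: "\<And>u v. w u v = w v u"
    and conn: "connected_graph (pos_edges E w)" and two: "CARD('v) \<ge> 2"
    and adm: "admissible E w \<phi> \<alpha>"
  shows "\<phi> u > 0"
proof -
  obtain v where v: "v \<noteq> u" using exists_other[OF two] by blast
  obtain p where "p \<in> paths (pos_edges E w) u v" using conn unfolding connected_graph_def by blast
  then obtain xs where xs: "xs \<noteq> []" "hd xs = u" "last xs = v" "list_edges xs \<subseteq> pos_edges E w"
    by (auto simp: paths_def)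
  then obtain z ys where "xs = u # z # ys" using v
    by (cases xs; cases "tl xs") auto
  then have "{u, z} \<in> list_edges xs" by (force simp: list_edges_def)
  then have "{u, z} \<in> pos_edges E w" using xs by blast
  then have "0 < routed_weight E w \<phi> \<alpha> u z" using adm by (auto simp: admissible_def)
  also have "\<dots> \<le> w u z * \<phi> u * \<phi> z" using adm by (intro routed_weight_le \<phi> sym) (simp add: admissible_def)
  finally show ?thesis using \<phi>[of u] by (cases "\<phi> u = 0") auto
qed

lemma routed_cheeger_le:
  fixes E :: "'v::finite set set"
  assumes sym: "\<And>u v. w u v = w v u" and m: "\<And>u. deg w u * (\<phi> u)\<^sup>2 > 0"
    and nonneg: "\<And>u v. routed_kernel E w \<phi> \<alpha> u v \<ge> 0"
    and T: "T \<noteq> {}" "(\<Sum>u\<in>T. deg w u * (\<phi> u)\<^sup>2) \<le> (\<Sum>u\<in>-T. deg w u * (\<phi> u)\<^sup>2)"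
  shows "routed_cheeger E w \<phi> \<alpha> * (\<Sum>u\<in>T. deg w u * (\<phi> u)\<^sup>2) \<le> cut_weight (routed_kernel E w \<phi> \<alpha>) T"
proof -
  define vol where "vol S = (\<Sum>u\<in>S. deg w u * (\<phi> u)\<^sup>2)" for S
  define cut where "cut = cut_weight (routed_kernel E w \<phi> \<alpha>) T"
  have cut: "(\<Sum>e\<in>edge_boundary (pos_edges E w) T. on_edge (routed_weight E w \<phi> \<alpha>) e) = cut"
    unfolding cut_def by (rule sum_edge_boundary_routed_weight[OF sym])
  have cut0: "cut \<ge> 0" unfolding cut_def cut_weight_def by (intro sum_nonneg nonneg)
  have vT: "vol T > 0" unfolding vol_def using T(1) m by (intro sum_pos) auto
  then have "vol (- T) > 0" using T(2) by (simp add: vol_def)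
  then have "T \<noteq> UNIV" by (auto simp: vol_def)
  then have "routed_cheeger E w \<phi> \<alpha> \<le> (MAX S'\<in>{T, - T}. cut / vol S')"
    unfolding routed_cheeger_def cut[symmetric] vol_def using T(1) by (intro Min_le) auto
  also have "\<dots> \<le> cut / vol T"
    using vT T(2) cut0 by (auto simp: vol_def intro: divide_left_mono)
  finally show ?thesis using vT by (simp add: pos_le_divide_eq flip: vol_def cut_def)
qed

lemma routed_cheeger_nonneg:
  fixes E :: "'v::finite set set"
  assumes two: "CARD('v) \<ge> 2" and sym: "\<And>u v. w u v = w v u" and d: "\<And>u. deg w u \<ge> 0"
    and nonneg: "\<And>u v. routed_kernel E w \<phi> \<alpha> u v \<ge> 0"
  shows "routed_cheeger E w \<phi> \<alpha> \<ge> 0"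
proof -
  have ne: "{S :: 'v set. S \<noteq> {} \<and> S \<noteq> UNIV} \<noteq> {}"
    using exists_other[OF two, of undefined] by blast
  have "0 \<le> (MAX S'\<in>{S, - S}. cut_weight (routed_kernel E w \<phi> \<alpha>) S / (\<Sum>u\<in>S'. deg w u * (\<phi> u)\<^sup>2))" for S
  proof -
    have "0 \<le> cut_weight (routed_kernel E w \<phi> \<alpha>) S" unfolding cut_weight_def by (intro sum_nonneg nonneg)
    then have "0 \<le> cut_weight (routed_kernel E w \<phi> \<alpha>) S / (\<Sum>u\<in>S. deg w u * (\<phi> u)\<^sup>2)"
      using d by (intro divide_nonneg_nonneg sum_nonneg mult_nonneg_nonneg) auto
    then show ?thesis by (simp add: le_max_iff_disj)
  qed
  then show ?thesis
    unfolding routed_cheeger_def sum_edge_boundary_routed_weight[OF sym] using ne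
    by (subst Min_ge_iff) auto
qed

section \<open>The gap bound\<close>

text \<open>
  The trial function \<open>g\<close> is the second eigenvector divided by the ground-state eigenvector. Its
  energy is \<open>l\<close> times its mass in the form of \<open>H - lam 0\<close>, hence at most that in the routed form. The
  degrees of the routed kernel are bounded by the same comparison applied to indicators of vertices:
  the diagonal entries of \<open>H - lam 0\<close> are at most \<open>\<rho>\<close>.
\<close>

lemma routed_cheeger_bound:
  fixes E :: "'v::finite set set"
  assumes E: "\<And>e. e \<in> E \<Longrightarrow> card e = 2" and sym: "\<And>u v. w u v = w v u"
    and support: "\<And>u v. w u v \<noteq> 0 \<Longrightarrow> {u, v} \<in> E" and d: "\<And>u. deg w u > 0"
    and eig: "ordered_eigenvalues (schrodinger_matrix w W) lam"
    and two: "CARD('v) \<ge> 2" and gap: "lam 0 < lam 1"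
    and gs: "ground_state w W (lam 0) \<phi>" and \<phi>: "\<And>u. \<phi> u \<ge> 0"
    and conn: "connected_graph (pos_edges E w)" and adm: "admissible E w \<phi> \<alpha>"
  defines "\<rho> \<equiv> lam (CARD('v) - 1) - lam 0" and "l \<equiv> lam 1 - lam 0"
  shows "0 \<le> routed_cheeger E w \<phi> \<alpha>" and "(routed_cheeger E w \<phi> \<alpha>)\<^sup>2 \<le> l * (2 * (1 + \<rho>) - l)"
proof -
  define H where "H = schrodinger_matrix w W"
  define m where "m u = deg w u * (\<phi> u)\<^sup>2" for u
  define k where "k = routed_kernel E w \<phi> \<alpha>"
  define lift where "lift = ground_lift w \<phi>"
  let ?A = "\<lambda>u v. w u v * \<phi> u * \<phi> v"
  have pos: "\<phi> u > 0" for u by (rule ground_state_positive[OF \<phi> sym conn two adm])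
  have m_pos: "m u > 0" for u using d[of u] pos[of u] by (simp add: m_def)
  have diag: "w u u = 0" for u using support[of u u] E[of "{u, u}"] by auto
  have routing: "routing E w \<alpha>" using adm by (simp add: admissible_def)
  have k_nonneg: "k u v \<ge> 0" for u v
    using adm by (auto simp: k_def routed_kernel_def admissible_def less_imp_le)
  have k_sym: "k u v = k v u" for u v
    using routed_weight_commute[OF sym, where u = u and v = v] by (simp add: k_def routed_kernel_def insert_commute)
  have k_diag: "k u u = 0" for u
    using mem_pos_edges[OF sym, where u = u and v = u and E = E] by (simp add: k_def routed_kernel_def diag)
  show "0 \<le> routed_cheeger E w \<phi> \<alpha>"
    by (rule routed_cheeger_nonneg[OF two sym]) (simp_all add: d less_imp_le k_nonneg flip: k_def)
  have compare: "dirichlet_form k g \<le> dirichlet_form ?A g" for g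
    unfolding k_def by (rule dirichlet_form_routed_le[OF E sym support \<phi> routing])
  have energy: "dirichlet_form ?A g = lift g \<bullet> (H *v lift g) - lam 0 * (lift g \<bullet> lift g)" for g
    unfolding lift_def H_def by (rule ground_state_transform[OF sym d diag gs, symmetric])
  have lift_inner: "lift g \<bullet> lift g' = (\<Sum>u\<in>UNIV. m u * (g u * g' u))" for g g'
    unfolding lift_def m_def by (rule inner_ground_lift[OF d])
  have H_sym: "transpose H = H" unfolding H_def by (rule transpose_schrodinger_matrix[OF sym])
  have lam_mono: "lam i \<le> lam j" if "i \<le> j" "j < CARD('v)" for i j
    using eig that by (simp add: ordered_eigenvalues_def)
  have "lam 1 \<le> lam (CARD('v) - 1)" using two by (intro lam_mono) auto
  then have \<rho>: "l \<le> \<rho>" "0 \<le> \<rho>" using gap by (auto simp: l_def \<rho>_def)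
  have degree: "(\<Sum>v\<in>UNIV. k u v) \<le> (1 + \<rho>) * m u" for u
  proof -
    have norm: "lift (indicator {u}) \<bullet> lift (indicator {u}) = m u"
    proof -
      have "m v * (indicator {u} v * indicator {u} v) = (if v = u then m u else 0)" for v by simp
      then show ?thesis by (simp add: lift_inner)
    qed
    have "(\<Sum>v\<in>UNIV. k u v) = dirichlet_form k (indicator {u})"
      by (rule dirichlet_form_indicator[OF k_sym k_diag, symmetric])
    also note compare
    also have "dirichlet_form ?A (indicator {u}) \<le> \<rho> * m u"
      using rayleigh_le_largest_eigenvalue[OF H_sym, where lam = lam and x = "lift (indicator {u})"] eig
      by (simp add: energy norm \<rho>_def left_diff_distrib flip: H_def)
    also have "\<dots> \<le> (1 + \<rho>) * m u" using m_pos[of u] by (intro mult_right_mono) auto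
    finally show ?thesis .
  qed
  obtain x where x: "x \<noteq> 0" "H *v x = lam 1 *\<^sub>R x"
    using ordered_eigenvalues_iff[OF eig, of "lam 1"] two unfolding H_def by force
  define g where "g u = x $ u / (sqrt (deg w u) * \<phi> u)" for u
  have lift_g: "lift g = x"
    using d pos by (auto simp: vec_eq_iff lift_def ground_lift_def g_def less_imp_neq[symmetric])
  obtain z where "x $ z \<noteq> 0" using x(1) by (auto simp: vec_eq_iff)
  then have g_nonzero: "g z \<noteq> 0" using d[of z] pos[of z] by (simp add: g_def)
  have "lift (\<lambda>_. 1) \<bullet> x = 0"
  proof -
    have "lam 0 * (lift (\<lambda>_. 1) \<bullet> x) = (H *v lift (\<lambda>_. 1)) \<bullet> x"
      by (simp add: H_def lift_def ground_state_eigenvector[OF d diag gs])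
    also have "\<dots> = lam 1 * (lift (\<lambda>_. 1) \<bullet> x)"
      by (simp add: symmetric_matrix_inner[OF H_sym] x)
    finally show ?thesis using gap by simp
  qed
  then have centred: "(\<Sum>u\<in>UNIV. m u * g u) = 0" by (simp add: lift_inner flip: lift_g)
  have rayleigh: "dirichlet_form k g \<le> l * (\<Sum>u\<in>UNIV. m u * (g u)\<^sup>2)"
  proof -
    have "dirichlet_form ?A g = l * (lift g \<bullet> lift g)"
      by (simp add: energy lift_g x l_def left_diff_distrib)
    then show ?thesis using compare[of g] by (simp add: lift_inner power2_eq_square)
  qed
  show "(routed_cheeger E w \<phi> \<alpha>)\<^sup>2 \<le> l * (2 * (1 + \<rho>) - l)"
  proof (rule cheeger_inequality[OF k_sym k_nonneg degree _ _ m_pos centred g_nonzero rayleigh])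
    show "0 \<le> routed_cheeger E w \<phi> \<alpha>" by fact
    show "l \<le> 1 + \<rho>" using \<rho> by simp
    fix T assume "T \<noteq> {}" "sum m T \<le> sum m (- T)"
    then show "routed_cheeger E w \<phi> \<alpha> * sum m T \<le> cut_weight k T"
      using routed_cheeger_le[OF sym, where \<phi> = \<phi> and E = E and \<alpha> = \<alpha> and T = T] m_pos k_nonneg
      by (simp add: m_def[abs_def] k_def)
  qed
qed

theorem corollary5:
  fixes E :: "'v::finite set set" and w :: "'v \<Rightarrow> 'v \<Rightarrow> real"
    and W :: "'v \<Rightarrow> real" and \<phi> :: "'v \<Rightarrow> real" and lam :: "nat \<Rightarrow> real"
  assumes "\<forall>e\<in>E. card e = 2"
    and "\<forall>u v. w u v = w v u"
    and "\<forall>u v. w u v \<noteq> 0 \<longrightarrow> {u, v} \<in> E"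
    and "\<forall>u. deg w u > 0"
    and "ordered_eigenvalues (normalized_laplacian w + diagonal_matrix W) lam"
    and "CARD('v) \<ge> 2" and "lam 0 < lam 1"
    and "ground_state w W (lam 0) \<phi>" and "\<forall>u. \<phi> u \<ge> 0"
    and "connected_graph (pos_edges E w)"
    and "\<exists>\<alpha>. admissible E w \<phi> \<alpha>"
  shows "let \<rho> = lam (CARD('v) - 1) - lam 0; h = distributed_cheeger E w \<phi>
         in lam 1 - lam 0 \<ge> (1 + \<rho>) - sqrt ((1 + \<rho>)\<^sup>2 - h\<^sup>2)"
proof -
  define \<rho> where "\<rho> = lam (CARD('v) - 1) - lam 0"
  define l where "l = lam 1 - lam 0"
  define K where "K = l * (2 * (1 + \<rho>) - l)"
  define h where "h = distributed_cheeger E w \<phi>"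
  have nonneg: "0 \<le> routed_cheeger E w \<phi> \<alpha>" and square: "(routed_cheeger E w \<phi> \<alpha>)\<^sup>2 \<le> K"
    if "admissible E w \<phi> \<alpha>" for \<alpha>
    using routed_cheeger_bound[of E w W lam \<phi> \<alpha>] assms that
    by (simp_all add: K_def \<rho>_def l_def schrodinger_matrix_def)
  have le: "routed_cheeger E w \<phi> \<alpha> \<le> sqrt K" if "admissible E w \<phi> \<alpha>" for \<alpha>
    using square[OF that] by (rule real_le_rsqrt)
  obtain \<alpha> where \<alpha>: "admissible E w \<phi> \<alpha>" using assms by blast
  have "h \<le> sqrt K" unfolding h_def distributed_cheeger_def
    using \<alpha> le by (intro cSUP_least) auto
  moreover have "routed_cheeger E w \<phi> \<alpha> \<le> h" unfolding h_def distributed_cheeger_def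
    using \<alpha> le by (intro cSUP_upper bdd_aboveI2[where M = "sqrt K"]) auto
  ultimately have "h\<^sup>2 \<le> (sqrt K)\<^sup>2" using nonneg[OF \<alpha>] by (intro power_mono) auto
  also have "(sqrt K)\<^sup>2 = K"
    using square[OF \<alpha>] by (intro real_sqrt_pow2) (meson order_trans zero_le_power2)
  also have "K = (1 + \<rho>)\<^sup>2 - (1 + \<rho> - l)\<^sup>2" by (simp add: K_def power2_eq_square algebra_simps)
  finally have "1 + \<rho> - l \<le> sqrt ((1 + \<rho>)\<^sup>2 - h\<^sup>2)" by (intro real_le_rsqrt) simp
  then show ?thesis by (simp add: Let_def \<rho>_def l_def h_def)
qed

end
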